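(* Let $h:\mathbb{Z}[1,T]\to\mathbb{R}^N$. If there are constants $\alpha,c\ge0$ such that $$|\nabla_vF(n,v)|\le c(|v|^\alpha+1)\qquad(n\in\mathbb{Z}[1,T],\ v\in\mathbb{R}^N)$$ and $$\lim_{|v|\to\infty}|v|^{-\alpha}\left[\overline{F}(v)+\langle\overline{h}|v\rangle\right]=-\infty,$$ then the functional $\mathcal{E}_h$ is bounded from below and attains its infimum at some $u\in D(\Psi+J)$, which is a solution of the problem $$\begin{cases}-\Delta[\phi(\Delta u(n-1))]=\nabla_u F(n,u(n))+h(n) & (n\in\mathbb{Z}[1,T]),\\ (\phi(\Delta u(0)),-\phi(\Delta u(T)))\in\partial j(u(0),u(T+1)).\end{cases}$$
   Context: $N\ge 1$ and $T\ge 2$ are fixed integers and $a>0$ is fixed. $\langle\cdot|\cdot\rangle$ and $|\cdot|$ are the Euclidean inner product and norm on $\mathbb{R}^N$, and $\mathbb{R}^N\times\mathbb{R}^N$ carries its usual inner product. $B_a=\{x\in\mathbb{R}^N:|x|<a\}$. $\mathbb{Z}[p,q]=\{p,\dots,q\}$. $X_{T+2}=\{u:\mathbb{Z}[0,T+1]\to\mathbb{R}^N\}$. $\overline{h}=\frac1T\sum_{k=1}^Th(k)$ and $\overline{F}(v)=\frac1T\sum_{n=1}^TF(n,v)$ for $v\in\mathbb{R}^N$. $\Delta u(n-1)=u(n)-u(n-1)$, $\Delta[\phi(\Delta u(n-1))]=\phi(\Delta u(n))-\phi(\Delta u(n-1))$, $\|\Delta u\|_\infty=\max_{n\in\mathbb{Z}[1,T+1]}|\Delta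 u(n-1)|$. The convention $0^0=0$ is used when $\alpha=0$. Assumptions. (1) $\phi: B_a\to\mathbb{R}^N$ is a homeomorphism from $B_a$ onto $\mathbb{R}^N$ with $\phi(0)=0$ and $\phi=\nabla\Phi$ on $B_a$, where $\Phi:\overline{B}_a\to\mathbb{R}$ is of class $C^1$ on $B_a$, continuous and strictly convex on $\overline{B}_a$, $\Phi(0)=0$. (2) $F=F(n,u):\mathbb{Z}[1,T]\times\mathbb{R}^N\to\mathbb{R}$ is continuous, $\nabla_uF$ exists and is continuous on $\mathbb{Z}[1,T]\times\mathbb{R}^N$, and $F(\cdot,0)=0$. (3) $j:\mathbb{R}^N\times\mathbb{R}^N\to(-\infty,+\infty]$ is proper, convex, lower semicontinuous, $j(0,0)=0$ and $(0,0)\in\partial j(0,0)$, where $\partial j$ is the subdifferential in the sense of convex analysis; $D(j)=\{z:j(z)<+\infty\}$. Functionals on $X_{T+2}$: $\Psi(u)=\sum_{n=1}^{T+1}\Phi[\Delta u(n-1)]$ if $\|\Delta u\|_\infty\le a$ and $\Psi(u)=+\infty$ otherwise; $J(u)=j(u(0),u(T+1))$; $\mathcal{E}_h(u)=\Psi(u)+J(u)-\sum_{n=1}^TF(n,u(n))-\sum_{n=1}^T\langle h(n)|u(n)\rangle$. $D(\Psi+J)=\{u\in X_{T+2}:\|\Delta u\|_\infty\le a,\ (u(0),u(T+1))\in D(j)\}$. A solution of the problem is a function $u\in X_{T+2}$ with $\|\Delta u\|_\infty<a$ and $\partial j(u(0),u(T+1))\neq\emptyset$ that satisfies both the equations and the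 boundary condition. *)

theory Defs
  imports "HOL-Analysis.Analysis"
begin

subsection \<open>Gradients\<close>

definition grad :: "('a::euclidean_space \<Rightarrow> real) \<Rightarrow> 'a \<Rightarrow> 'a" where
  "grad f x = (THE D. GDERIV f x :> D)"

lemma grad_eqI:
  assumes "GDERIV f x :> D"
  shows "grad f x = D"
  unfolding grad_def
proof (rule the_equality)
  show "GDERIV f x :> D" by (rule assms)
next
  fix E assume "GDERIV f x :> E"
  then have "(\<lambda>h. inner h E) = (\<lambda>h. inner h D)"
    using assms unfolding gderiv_def by (rule has_derivative_unique)
  then have "inner (E - D) (E - D) = 0"
    by (metis inner_diff_right diff_self)
  then show "E = D" by simp
qed

lemma GDERIV_grad:
  assumes "f differentiable (at x)"
  shows "GDERIV f x :> grad f x"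
proof -
  obtain f' where f': "(f has_derivative f') (at x)"
    using assms by (auto simp: differentiable_def)
  have "f' h = inner h (\<Sum>b\<in>Basis. f' b *\<^sub>R b)" for h
    using Linear_Algebra.linear_componentwise[OF has_derivative_linear[OF f'], of h 1]
    by (simp add: inner_sum_right mult.commute)
  then have "f' = (\<lambda>h. inner h (\<Sum>b\<in>Basis. f' b *\<^sub>R b))"
    by (rule ext)
  then have "GDERIV f x :> (\<Sum>b\<in>Basis. f' b *\<^sub>R b)"
    using f' unfolding gderiv_def by simp
  then show ?thesis using grad_eqI by metis
qed

definition C1_on :: "'a::euclidean_space set \<Rightarrow> ('a \<Rightarrow> real) \<Rightarrow> bool" where
  "C1_on S f \<longleftrightarrow> (\<forall>x\<in>S. f differentiable (at x)) \<and> continuous_on S (grad f)"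

subsection \<open>Convex analysis\<close>

definition strictly_convex_on :: "'a::real_vector set \<Rightarrow> ('a \<Rightarrow> real) \<Rightarrow> bool" where
  "strictly_convex_on S f \<longleftrightarrow> convex S \<and>
     (\<forall>x\<in>S. \<forall>y\<in>S. \<forall>t. x \<noteq> y \<and> 0 < t \<and> t < 1 \<longrightarrow>
        f ((1 - t) *\<^sub>R x + t *\<^sub>R y) < (1 - t) * f x + t * f y)"

definition proper_fun :: "('a \<Rightarrow> ereal) \<Rightarrow> bool" where
  "proper_fun f \<longleftrightarrow> (\<forall>x. f x \<noteq> -\<infinity>) \<and> (\<exists>x. f x \<noteq> \<infinity>)"

(* The end points t = 0 and t = 1 are harmless, since 0 * \<infinity> = 0 in ereal. *)
definition convex_fun :: "('a::real_vector \<Rightarrow> ereal) \<Rightarrow> bool" where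
  "convex_fun f \<longleftrightarrow>
     (\<forall>x y t. 0 \<le> t \<and> t \<le> 1 \<longrightarrow>
        f ((1 - t) *\<^sub>R x + t *\<^sub>R y) \<le> ereal (1 - t) * f x + ereal t * f y)"

definition lsc_fun :: "('a::topological_space \<Rightarrow> ereal) \<Rightarrow> bool" where
  "lsc_fun f \<longleftrightarrow> (\<forall>x. f x \<le> Liminf (at x) f)"

definition eff_dom :: "('a \<Rightarrow> ereal) \<Rightarrow> 'a set" where
  "eff_dom f = {x. f x < \<infinity>}"

(* For proper f this set is empty whenever f x = \<infinity>. *)
definition subdiff :: "('a::real_inner \<Rightarrow> ereal) \<Rightarrow> 'a \<Rightarrow> 'a set" where
  "subdiff f x = {\<zeta>. \<forall>y. f x + ereal (inner \<zeta> (y - x)) \<le> f y}"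

subsection \<open>The variational setting\<close>

(* Functions on Z[0,T+1], encoded as functions on nat that are undefined elsewhere. *)
definition X_space :: "nat \<Rightarrow> (nat \<Rightarrow> 'a) set" where
  "X_space T = {0..T + 1} \<rightarrow>\<^sub>E UNIV"

definition fdiff :: "(nat \<Rightarrow> 'a::ab_group_add) \<Rightarrow> nat \<Rightarrow> 'a" where
  "fdiff u n = u (n + 1) - u n"

definition fdiff_norm :: "nat \<Rightarrow> (nat \<Rightarrow> 'a::real_normed_vector) \<Rightarrow> real" where
  "fdiff_norm T u = Max ((\<lambda>n. norm (fdiff u (n - 1))) ` {1..T + 1})"

definition mean :: "nat \<Rightarrow> (nat \<Rightarrow> 'a::real_vector) \<Rightarrow> 'a" where
  "mean T g = (1 / real T) *\<^sub>R (\<Sum>n=1..T. g n)"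

definition Psi ::
  "nat \<Rightarrow> real \<Rightarrow> ('a::real_normed_vector \<Rightarrow> real) \<Rightarrow> (nat \<Rightarrow> 'a) \<Rightarrow> ereal" where
  "Psi T a \<Phi> u =
     (if fdiff_norm T u \<le> a then ereal (\<Sum>n=1..T + 1. \<Phi> (fdiff u (n - 1))) else \<infinity>)"

definition J_fun :: "nat \<Rightarrow> ('a \<times> 'a \<Rightarrow> ereal) \<Rightarrow> (nat \<Rightarrow> 'a) \<Rightarrow> ereal" where
  "J_fun T j u = j (u 0, u (T + 1))"

definition Energy ::
  "nat \<Rightarrow> real \<Rightarrow> ('a::real_inner \<Rightarrow> real) \<Rightarrow> ('a \<times> 'a \<Rightarrow> ereal) \<Rightarrow> (nat \<Rightarrow> 'a \<Rightarrow> real)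
     \<Rightarrow> (nat \<Rightarrow> 'a) \<Rightarrow> (nat \<Rightarrow> 'a) \<Rightarrow> ereal" where
  "Energy T a \<Phi> j F h u =
     Psi T a \<Phi> u + J_fun T j u - ereal (\<Sum>n=1..T. F n (u n)) - ereal (\<Sum>n=1..T. inner (h n) (u n))"

definition dom_PsiJ ::
  "nat \<Rightarrow> real \<Rightarrow> ('a::real_normed_vector \<times> 'a \<Rightarrow> ereal) \<Rightarrow> (nat \<Rightarrow> 'a) set" where
  "dom_PsiJ T a j = {u \<in> X_space T. fdiff_norm T u \<le> a \<and> (u 0, u (T + 1)) \<in> eff_dom j}"

definition is_solution ::
  "nat \<Rightarrow> real \<Rightarrow> ('a::euclidean_space \<Rightarrow> 'a) \<Rightarrow> ('a \<times> 'a \<Rightarrow> ereal) \<Rightarrow> (nat \<Rightarrow> 'a \<Rightarrow> real)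
     \<Rightarrow> (nat \<Rightarrow> 'a) \<Rightarrow> (nat \<Rightarrow> 'a) \<Rightarrow> bool" where
  "is_solution T a \<phi> j F h u \<longleftrightarrow>
     u \<in> X_space T \<and> fdiff_norm T u < a \<and> subdiff j (u 0, u (T + 1)) \<noteq> {} \<and>
     (\<forall>n\<in>{1..T}. - fdiff (\<lambda>k. \<phi> (fdiff u k)) (n - 1) = grad (F n) (u n) + h n) \<and>
     (\<phi> (fdiff u 0), - \<phi> (fdiff u T)) \<in> subdiff j (u 0, u (T + 1))"

end

theory Submission
  imports Defs
begin

text \<open>
  The solution is found by minimizing the energy. If all differences of \<open>u\<close> have norm at most
  \<open>a\<close>, then \<open>u\<close> stays within a fixed distance of \<open>u 0\<close>. By the growth condition on the
  gradients, replacing every \<open>u n\<close> by \<open>u 0\<close> changes the potential by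
  \<open>O(norm (u 0) powr \<alpha>)\<close> for large \<open>u 0\<close>, so the limit hypothesis on the averaged potential
  makes the potential tend to minus infinity as \<open>u 0\<close> grows (\<open>potential_coercive\<close>). As \<open>j\<close> is
  nonnegative and \<open>\<Phi>\<close> is bounded on the closed ball, the energy is coercive, and it attains its
  infimum on a compact set by lower semicontinuity (\<open>Energy_attains_min\<close>).

  The energy is infinite as soon as some difference is longer than \<open>a\<close>, so a minimizer could a
  priori touch the constraint. It does not: \<open>\<phi>\<close> is a homeomorphism of the open ball onto the whole
  space, so its norm tends to infinity at the sphere, and by convexity \<open>\<Phi>\<close> decreases with infinite slope when one
  moves from the sphere towards 0 (\<open>convex_steep_at_sphere\<close>). Shrinking \<open>u\<close> towards the zero
  function would therefore lower the energy (\<open>minimizer_strictly_inside\<close>).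

  Once all differences are shorter than \<open>a\<close>, every direction is admissible for \<open>\<Phi>\<close>. The first
  variation, in which convexity replaces differentiability of \<open>j\<close>, is the inequality
  \<open>minimizer_variational_inequality\<close>. Perturbations at one interior node give the difference
  equation, and perturbations at the two end nodes give the subdifferential boundary condition.
\<close>

section \<open>Gradients and convexity\<close>

text \<open>
  The first-order condition in the form used below: the error term \<open>t * c\<close> absorbs the
  nonsmooth convex contributions, which are only controlled along chords.
\<close>

lemma right_derivative_ge:
  fixes g :: "real \<Rightarrow> real"
  assumes deriv: "(g has_real_derivative D) (at 0)"
    and le: "eventually (\<lambda>t. g 0 \<le> g t + t * c) (at_right 0)"
  shows "0 \<le> D + c"
proof -
  have "((\<lambda>t. (g t - g 0) / t) \<longlongrightarrow> D) (at 0)"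
    using deriv by (simp add: has_field_derivative_iff)
  then have lim: "((\<lambda>t. (g t - g 0) / t) \<longlongrightarrow> D) (at_right 0)"
    by (rule tendsto_mono[rotated]) (simp add: at_le)
  have "eventually (\<lambda>t. - c \<le> (g t - g 0) / t) (at_right 0)"
    using eventually_at_right_less[of 0] le
  proof eventually_elim
    case (elim t)
    then show ?case by (simp add: field_simps)
  qed
  then have "- c \<le> D"
    by (rule tendsto_lowerbound[OF lim]) simp
  then show ?thesis by simp
qed

lemma GDERIV_along_line:
  assumes "GDERIV f x :> D"
  shows "((\<lambda>t. f (x + t *\<^sub>R v)) has_real_derivative inner D v) (at 0)"
proof -
  have "(f has_derivative (\<lambda>h. inner h D)) (at (x + 0 *\<^sub>R v))"
    using assms by (simp add: gderiv_def)
  then have "((\<lambda>t. f (x + t *\<^sub>R v)) has_derivative (\<lambda>t. inner (t *\<^sub>R v) D)) (at 0)"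
    by (intro has_derivative_compose[where g = f and f = "\<lambda>t. x + t *\<^sub>R v"])
      (auto intro!: derivative_eq_intros)
  then show ?thesis
    by (simp add: has_field_derivative_def inner_commute mult.commute[of "inner D v"] mult_commute_abs)
qed

lemma strictly_convex_on_imp_convex_on:
  assumes "strictly_convex_on S f"
  shows "convex_on S f"
proof
  show "convex S" using assms by (simp add: strictly_convex_on_def)
  fix t :: real and x y
  assume *: "t > 0" "t < 1" "x \<in> S" "y \<in> S"
  show "f ((1 - t) *\<^sub>R x + t *\<^sub>R y) \<le> (1 - t) * f x + t * f y"
  proof (cases "x = y")
    case True
    then show ?thesis by (simp flip: scaleR_left_distrib distrib_right)
  next
    case False
    then show ?thesis using assms * by (force simp: strictly_convex_on_def)
  qed
qed

lemma convex_on_above_tangent_plane: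
  assumes conv: "convex_on S f" and "x \<in> S" "y \<in> S" and "GDERIV f x :> D"
  shows "f x + inner D (y - x) \<le> f y"
proof -
  have "((\<lambda>t. - f (x + t *\<^sub>R (y - x))) has_real_derivative - inner D (y - x)) (at 0)"
    by (intro DERIV_minus GDERIV_along_line assms)
  then have "0 \<le> - inner D (y - x) + (f y - f x)"
  proof (rule right_derivative_ge[OF _ eventually_at_rightI[of 0 1]])
    fix t :: real
    assume t: "t \<in> {0<..<1}"
    have "f ((1 - t) *\<^sub>R x + t *\<^sub>R y) \<le> (1 - t) * f x + t * f y"
      using conv assms(2,3) t by (intro convex_onD) auto
    moreover have "(1 - t) *\<^sub>R x + t *\<^sub>R y = x + t *\<^sub>R (y - x)"
      by (simp add: algebra_simps)
    ultimately show "- f (x + 0 *\<^sub>R (y - x)) \<le> - f (x + t *\<^sub>R (y - x)) + t * (f y - f x)"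
      by (simp add: algebra_simps)
  qed simp
  then show ?thesis by simp
qed

text \<open>
  The preimage of a closed ball is compact, so it stays away from the sphere of radius \<open>a\<close>.
\<close>

lemma homeomorphism_ball_UNIV_blowup:
  fixes \<phi> :: "'a::euclidean_space \<Rightarrow> 'a"
  assumes hom: "homeomorphism (ball 0 a) UNIV \<phi> \<psi>"
  shows "\<exists>\<rho><a. \<forall>x\<in>ball 0 a. \<rho> < norm x \<longrightarrow> B < norm (\<phi> x)"
proof -
  let ?K = "\<psi> ` cball 0 \<bar>B\<bar>"
  have "compact ?K"
    using hom by (intro compact_continuous_image compact_cball)
      (auto simp: homeomorphism_def intro: continuous_on_subset)
  moreover have "?K \<noteq> {}" by simp
  ultimately obtain z where z: "z \<in> ?K" "\<And>x. x \<in> ?K \<Longrightarrow> norm x \<le> norm z"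
    using continuous_attains_sup[of ?K norm] by (auto intro: continuous_on_norm_id)
  have "z \<in> ball 0 a" using z(1) hom by (auto simp: homeomorphism_def)
  moreover have "B < norm (\<phi> x)" if "x \<in> ball 0 a" "norm z < norm x" for x
  proof (rule ccontr)
    assume "\<not> B < norm (\<phi> x)"
    then have "x \<in> ?K"
      using that hom by (intro image_eqI[of _ _ "\<phi> x"]) (auto simp: homeomorphism_def)
    then show False using z(2)[of x] that by simp
  qed
  ultimately show ?thesis by (intro exI[of _ "norm z"]) auto
qed

section \<open>Lower semicontinuity and attainment of minima\<close>

lemma lsc_fun_open_superlevel:
  assumes "lsc_fun f"
  shows "open {z. c < f z}"
proof (subst open_subopen, safe)
  fix z assume "c < f z"
  moreover have "f z \<le> Liminf (at z) f"
    using assms by (simp add: lsc_fun_def)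
  ultimately have "eventually (\<lambda>y. c < f y) (nhds z)"
    unfolding eventually_nhds_conv_at by (auto simp: le_Liminf_iff)
  then show "\<exists>U. open U \<and> z \<in> U \<and> U \<subseteq> {z. c < f z}"
    unfolding eventually_nhds by blast
qed

text \<open>
  Lower semicontinuity is required only relative to \<open>K\<close>. If every \<open>f x\<close> were undercut by some
  \<open>f (b x)\<close>, finitely many of the open sets where \<open>f\<close> exceeds \<open>f (b x)\<close> would cover \<open>K\<close>,
  and the smallest of the corresponding values \<open>f (b x)\<close> would exceed some other one.
\<close>

lemma compact_lsc_attains_min:
  fixes f :: "'a::topological_space \<Rightarrow> 'b::linorder"
  assumes "compact K" "K \<noteq> {}"
    and lsc: "\<And>x c. x \<in> K \<Longrightarrow> c < f x \<Longrightarrow> \<exists>U. open U \<and> x \<in> U \<and> (\<forall>y\<in>U \<inter> K. c < f y)"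
  shows "\<exists>x\<in>K. \<forall>y\<in>K. f x \<le> f y"
proof (rule ccontr)
  assume "\<not> ?thesis"
  then have "\<forall>x\<in>K. \<exists>y\<in>K. f y < f x" by (meson not_le)
  then obtain b where b: "\<And>x. x \<in> K \<Longrightarrow> b x \<in> K" "\<And>x. x \<in> K \<Longrightarrow> f (b x) < f x" by metis
  then have "\<forall>x\<in>K. \<exists>U. open U \<and> x \<in> U \<and> (\<forall>y\<in>U \<inter> K. f (b x) < f y)"
    using lsc by blast
  then obtain U where U: "\<And>x. x \<in> K \<Longrightarrow> open (U x)" "\<And>x. x \<in> K \<Longrightarrow> x \<in> U x"
    "\<And>x y. x \<in> K \<Longrightarrow> y \<in> U x \<inter> K \<Longrightarrow> f (b x) < f y" by metis
  obtain C where C: "C \<subseteq> K" "finite C" "K \<subseteq> (\<Union>x\<in>C. U x)"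
  proof (rule compactE_image[OF \<open>compact K\<close>, of K U])
    show "K \<subseteq> (\<Union>x\<in>K. U x)" using U(2) by blast
  qed (use U(1) in auto)
  with \<open>K \<noteq> {}\<close> have "C \<noteq> {}" by auto
  then obtain x where x: "x \<in> C" "\<And>y. y \<in> C \<Longrightarrow> f (b x) \<le> f (b y)"
    using ex_min_if_finite[of "(f \<circ> b) ` C"] C(2) by (force simp: not_less)
  then obtain y where "y \<in> C" "b x \<in> U y" using C b(1) by blast
  then have "f (b y) < f (b x)" using U(3)[of y "b x"] C(1) b(1) x(1) by blast
  then show False using x(2)[OF \<open>y \<in> C\<close>] by simp
qed

lemma lsc_add_continuous:
  fixes f :: "'a::topological_space \<Rightarrow> real" and g :: "'a \<Rightarrow> ereal"
  assumes f: "continuous_on K f" and g: "\<And>r. open {x. r < g x}" and "\<And>x. g x \<noteq> -\<infinity>"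
    and "x \<in> K" and c: "c < ereal (f x) + g x"
  shows "\<exists>U. open U \<and> x \<in> U \<and> (\<forall>y\<in>U \<inter> K. c < ereal (f y) + g y)"
proof -
  \<comment> \<open>Split the margin between \<open>c\<close> and \<open>f x + g x\<close> between the two summands.\<close>
  have "\<exists>r s. ereal r < g x \<and> s < f x \<and> c \<le> ereal (s + r)"
  proof (cases "g x")
    case (real q)
    with c have "c < ereal (f x + q)" by simp
    then obtain d where d: "c < ereal d" "d < f x + q"
      using ereal_dense2[of c "ereal (f x + q)"] by auto
    have "ereal (q - (f x + q - d) / 2) < g x"
      "f x - (f x + q - d) / 2 < f x"
      using d(2) real by auto
    moreover have "c \<le> ereal ((f x - (f x + q - d) / 2) + (q - (f x + q - d) / 2))"
      using d(1) by (simp add: field_simps)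
    ultimately show ?thesis by blast
  next
    case PInf
    from c have "c \<noteq> \<infinity>" by auto
    then obtain d where d: "c \<le> ereal d" by (cases c) auto
    have "ereal (d - (f x - 1)) < g x" "f x - 1 < f x" using PInf by auto
    moreover have "c \<le> ereal ((f x - 1) + (d - (f x - 1)))" using d by simp
    ultimately show ?thesis by blast
  qed (use assms in auto)
  then obtain r s where rs: "ereal r < g x" "s < f x" "c \<le> ereal (s + r)" by blast
  obtain V where V: "open V" "V \<inter> K = f -` {s<..} \<inter> K"
    using f unfolding continuous_on_open_invariant by (meson open_greaterThan)
  have "c < ereal (f y) + g y" if "y \<in> V \<inter> {x. ereal r < g x}" "y \<in> K" for y
  proof -
    have "s < f y" "ereal r < g y" using that V by auto
    then have "ereal s + ereal r < ereal (f y) + g y"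
      by (intro ereal_add_strict_mono2) auto
    then show ?thesis using rs(3) by simp
  qed
  then show ?thesis
    using V rs g[of r] \<open>x \<in> K\<close>
    by (intro exI[of _ "V \<inter> {x. ereal r < g x}"]) auto
qed

section \<open>The energy and its domain\<close>

lemma fdiff_norm_eq_Max: "fdiff_norm T u = Max ((\<lambda>k. norm (fdiff u k)) ` {..T})"
proof -
  have "(\<lambda>n. norm (fdiff u (n - 1))) ` {1..T + 1} = (\<lambda>k. norm (fdiff u k)) ` {..T}"
    by (force simp: image_iff intro: bexI[of _ "Suc _"])
  then show ?thesis by (simp add: fdiff_norm_def)
qed

lemma fdiff_norm_le_iff: "fdiff_norm T u \<le> a \<longleftrightarrow> (\<forall>k\<le>T. norm (fdiff u k) \<le> a)"
  by (auto simp: fdiff_norm_eq_Max)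

lemma fdiff_norm_less_iff: "fdiff_norm T u < a \<longleftrightarrow> (\<forall>k\<le>T. norm (fdiff u k) < a)"
  by (auto simp: fdiff_norm_eq_Max)

text \<open>
  The part of the energy that comes from \<open>F\<close> and the forcing \<open>h\<close>; the energy contains it with a
  minus sign.
\<close>

definition potential ::
  "nat \<Rightarrow> (nat \<Rightarrow> 'a::real_inner \<Rightarrow> real) \<Rightarrow> (nat \<Rightarrow> 'a) \<Rightarrow> (nat \<Rightarrow> 'a) \<Rightarrow> real" where
  "potential T F h u = (\<Sum>n=1..T. F n (u n) + inner (h n) (u n))"

lemma Energy_inside:
  assumes "fdiff_norm T u \<le> a"
  shows "Energy T a \<Phi> j F h u =
    ereal ((\<Sum>k\<le>T. \<Phi> (fdiff u k)) - potential T F h u) + j (u 0, u (T + 1))"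
proof -
  have "(\<Sum>n=1..T + 1. \<Phi> (fdiff u (n - 1))) = (\<Sum>k\<le>T. \<Phi> (fdiff u k))"
    by (rule sum.reindex_bij_witness[of _ Suc "\<lambda>n. n - 1"]) auto
  then show ?thesis
    using assms
    by (cases "j (u 0, u (T + 1))")
      (simp_all add: Energy_def Psi_def J_fun_def potential_def sum.distrib)
qed

lemma Energy_outside:
  assumes "\<not> fdiff_norm T u \<le> a" "j (u 0, u (T + 1)) \<noteq> -\<infinity>"
  shows "Energy T a \<Phi> j F h u = \<infinity>"
  using assms by (simp add: Energy_def Psi_def J_fun_def)

text \<open>
  Only the values on \<open>{0..T + 1}\<close> matter. Hence minimality over \<open>X_space T\<close> is minimality over
  all functions on the naturals, and perturbations need not be truncated.
\<close>

lemma Energy_restrict: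
  "Energy T a \<Phi> j F h (restrict v {0..T + 1}) = Energy T a \<Phi> j F h v"
proof -
  have "fdiff (restrict v {0..T + 1}) (n - 1) = fdiff v (n - 1)" if "n \<in> {1..T + 1}" for n
    using that by (auto simp: fdiff_def)
  then have "fdiff_norm T (restrict v {0..T + 1}) = fdiff_norm T v"
    and "(\<Sum>n=1..T + 1. \<Phi> (fdiff (restrict v {0..T + 1}) (n - 1)))
       = (\<Sum>n=1..T + 1. \<Phi> (fdiff v (n - 1)))"
    unfolding fdiff_norm_def by (auto intro!: arg_cong[of _ _ Max] image_cong sum.cong)
  then show ?thesis
    by (simp add: Energy_def Psi_def J_fun_def)
qed

lemma norm_diff_le_of_fdiff_norm:
  assumes "fdiff_norm T u \<le> a" "n \<le> T + 1"
  shows "norm (u n - u 0) \<le> real n * a"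
  using assms(2)
proof (induction n)
  case (Suc n)
  have "norm (u (Suc n) - u n) \<le> a"
    using assms(1) Suc.prems by (auto simp: fdiff_norm_le_iff fdiff_def)
  moreover have "norm (u (Suc n) - u 0) \<le> norm (u (Suc n) - u n) + norm (u n - u 0)"
    using norm_triangle_ineq[of "u (Suc n) - u n" "u n - u 0"] by simp
  ultimately show ?case using Suc by (auto simp: algebra_simps)
qed simp

text \<open>
  In the product topology on functions on the naturals. The coordinates beyond \<open>T + 1\<close> are fixed at
  \<open>undefined\<close> and the others stay within \<open>(T + 1) * a\<close> of \<open>u 0\<close>, so Tychonoff's theorem applies.
\<close>

lemma compact_bounded_differences:
  fixes a M :: real
  assumes "a \<ge> 0"
  shows "compact {u \<in> X_space T. fdiff_norm T u \<le> a \<and> norm (u 0 :: 'a::euclidean_space) \<le> M}"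
proof -
  let ?S = "\<lambda>n. if n \<le> T + 1 then cball (0::'a) (M + (real T + 1) * a) else {undefined}"
  have "compactin (product_topology (\<lambda>_. euclidean) UNIV) (PiE UNIV ?S)"
    unfolding compactin_PiE by (auto simp: compactin_euclidean_iff)
  then have cpt: "compact (PiE UNIV ?S)"
    by (simp add: euclidean_product_topology compactin_euclidean_iff)
  let ?C = "{u. norm (u 0 :: 'a) \<le> M} \<inter> (\<Inter>k\<in>{..T}. {u. norm (u (k + 1) - u k) \<le> a})"
  have "closed ?C"
    by (intro closed_Int closed_INT ballI closed_Collect_le continuous_intros
        continuous_on_product_coordinates)
  then have "compact (PiE UNIV ?S \<inter> ?C)" using cpt by blast
  also have "PiE UNIV ?S \<inter> ?C
      = {u \<in> X_space T. fdiff_norm T u \<le> a \<and> norm (u 0 :: 'a) \<le> M}" (is "_ = ?R")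
  proof (intro set_eqI iffI)
    fix u assume "u \<in> PiE UNIV ?S \<inter> ?C"
    then show "u \<in> ?R"
      by (auto simp: X_space_def PiE_iff extensional_def fdiff_norm_le_iff fdiff_def
          split: if_splits)
  next
    fix u assume u: "u \<in> ?R"
    have "norm (u n) \<le> M + (real T + 1) * a" if "n \<le> T + 1" for n
    proof -
      have "norm (u n) \<le> norm (u 0) + norm (u n - u 0)"
        by (metis norm_triangle_sub)
      also have "\<dots> \<le> M + real n * a"
        using u norm_diff_le_of_fdiff_norm[of T u a n] that by auto
      also have "real n * a \<le> (real T + 1) * a"
        using that assms by (intro mult_right_mono) linarith+
      finally show ?thesis by simp
    qed
    then show "u \<in> PiE UNIV ?S \<inter> ?C"
      using u by (auto simp: X_space_def PiE_iff extensional_def fdiff_norm_le_iff fdiff_def)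
  qed
  finally show ?thesis .
qed

section \<open>Coercivity and existence of a minimizer\<close>

lemma GDERIV_increment_bound:
  fixes f :: "'a::euclidean_space \<Rightarrow> real"
  assumes deriv: "\<And>z. norm z \<le> r \<Longrightarrow> GDERIV f z :> g z"
    and bound: "\<And>z. norm z \<le> r \<Longrightarrow> norm (g z) \<le> L"
    and "norm x \<le> r" "norm y \<le> r"
  shows "f x - f y \<le> L * norm (x - y)"
proof -
  have "norm (f x - f y) \<le> L * norm (x - y)"
  proof (rule differentiable_bound[where S = "cball 0 r" and f' = "\<lambda>z k. inner k (g z)"])
    fix z :: 'a assume "z \<in> cball 0 r"
    then have z: "norm z \<le> r" by simp
    show "(f has_derivative (\<lambda>k. inner k (g z))) (at z within cball 0 r)"
      using deriv[OF z] by (auto simp: gderiv_def intro: has_derivative_at_withinI)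
    show "onorm (\<lambda>k. inner k (g z)) \<le> L"
    proof (rule onorm_le)
      fix k
      have "norm (inner k (g z)) \<le> norm k * norm (g z)" by (simp add: Cauchy_Schwarz_ineq2)
      also have "\<dots> \<le> norm k * L" by (intro mult_left_mono bound z) simp
      finally show "norm (inner k (g z)) \<le> L * norm k" by (simp add: mult.commute)
    qed
  qed (use assms in auto)
  then show ?thesis by simp
qed

text \<open>
  Replacing all values of \<open>u\<close> by one nearby large vector \<open>v\<close> costs at most a multiple of
  \<open>norm v powr \<alpha>\<close>, which is the scale on which the averaged potential is assumed to decay.
\<close>

lemma potential_le_mean:
  fixes F :: "nat \<Rightarrow> 'a::euclidean_space \<Rightarrow> real"
  assumes "T \<ge> 1" "\<alpha> \<ge> 0" "c \<ge> 0"
    and deriv: "\<And>n z. n \<in> {1..T} \<Longrightarrow> GDERIV (F n) z :> g n z"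
    and growth: "\<And>n z. n \<in> {1..T} \<Longrightarrow> norm (g n z) \<le> c * (norm z powr \<alpha> + 1)"
    and v: "1 \<le> norm v" "R \<le> norm v"
    and near: "\<And>n. n \<in> {1..T} \<Longrightarrow> norm (u n - v) \<le> R"
  shows "potential T F h u \<le> real T * (mean T (\<lambda>n. F n v) + inner (mean T h) v)
    + (\<Sum>n=1..T. c * (2 powr \<alpha> + 1) * R + norm (h n) * R) * norm v powr \<alpha>"
proof -
  define P where "P = norm v powr \<alpha>"
  have P: "1 \<le> P" using v \<open>\<alpha> \<ge> 0\<close> by (simp add: P_def ge_one_powr_ge_zero)
  have "F n (u n) + inner (h n) (u n)
      \<le> F n v + inner (h n) v + (c * (2 powr \<alpha> + 1) * R + norm (h n) * R) * P"
    if n: "n \<in> {1..T}" for n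
  proof -
    have R: "0 \<le> R" using near[OF n] norm_ge_zero order_trans by blast
    \<comment> \<open>Both \<open>u n\<close> and \<open>v\<close> lie in the ball of radius \<open>2 * norm v\<close>, because \<open>R \<le> norm v\<close>.\<close>
    have "F n (u n) - F n v \<le> (c * ((2 powr \<alpha> + 1) * P)) * norm (u n - v)"
    proof (rule GDERIV_increment_bound[where r = "2 * norm v" and g = "g n"])
      fix z :: 'a assume z: "norm z \<le> 2 * norm v"
      show "GDERIV (F n) z :> g n z" by (rule deriv[OF n])
      have "norm z powr \<alpha> \<le> (2 * norm v) powr \<alpha>"
        using z \<open>\<alpha> \<ge> 0\<close> by (intro powr_mono2) auto
      also have "\<dots> = 2 powr \<alpha> * P" by (simp add: powr_mult P_def)
      finally have "norm z powr \<alpha> + 1 \<le> (2 powr \<alpha> + 1) * P" using P by (simp add: algebra_simps)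
      then have "c * (norm z powr \<alpha> + 1) \<le> c * ((2 powr \<alpha> + 1) * P)"
        by (rule mult_left_mono) fact
      then show "norm (g n z) \<le> c * ((2 powr \<alpha> + 1) * P)"
        using growth[OF n, of z] by linarith
    next
      have "norm (u n) \<le> norm v + norm (u n - v)" by (rule norm_triangle_sub)
      then show "norm (u n) \<le> 2 * norm v" using near[OF n] v by linarith
    qed simp
    also have "\<dots> \<le> (c * ((2 powr \<alpha> + 1) * P)) * R"
      using P \<open>c \<ge> 0\<close> by (intro mult_left_mono near n mult_nonneg_nonneg) auto
    finally have 1: "F n (u n) - F n v \<le> (c * ((2 powr \<alpha> + 1) * P)) * R" .
    have "inner (h n) (u n - v) \<le> norm (h n) * norm (u n - v)" by (rule norm_cauchy_schwarz)
    also have "\<dots> \<le> norm (h n) * R" by (intro mult_left_mono near n) simp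
    also have "\<dots> \<le> (norm (h n) * R) * P"
      using mult_left_mono[OF P, of "norm (h n) * R"] R by simp
    finally show ?thesis using 1 by (simp add: inner_diff_right algebra_simps)
  qed
  then have "potential T F h u
      \<le> (\<Sum>n=1..T. F n v + inner (h n) v + (c * (2 powr \<alpha> + 1) * R + norm (h n) * R) * P)"
    unfolding potential_def by (rule sum_mono)
  moreover have "real T * (mean T (\<lambda>n. F n v) + inner (mean T h) v)
      = (\<Sum>n=1..T. F n v + inner (h n) v)"
    using \<open>T \<ge> 1\<close> by (simp add: mean_def sum.distrib inner_sum_left distrib_left)
  ultimately show ?thesis
    unfolding sum_distrib_right by (simp add: sum.distrib P_def)
qed

lemma potential_coercive:
  fixes F :: "nat \<Rightarrow> 'a::euclidean_space \<Rightarrow> real"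
  assumes "T \<ge> 1" "\<alpha> \<ge> 0" "c \<ge> 0" "a \<ge> 0"
    and deriv: "\<And>n z. n \<in> {1..T} \<Longrightarrow> GDERIV (F n) z :> g n z"
    and growth: "\<And>n z. n \<in> {1..T} \<Longrightarrow> norm (g n z) \<le> c * (norm z powr \<alpha> + 1)"
    and limit: "filterlim
      (\<lambda>v. norm v powr (- \<alpha>) * (mean T (\<lambda>n. F n v) + inner (mean T h) v)) at_bot at_infinity"
  shows "\<exists>M. \<forall>u. fdiff_norm T u \<le> a \<and> M \<le> norm (u 0) \<longrightarrow> potential T F h u \<le> B"
proof -
  define R where "R = real T * a"
  define K where "K = (\<Sum>n=1..T. c * (2 powr \<alpha> + 1) * R + norm (h n) * R)"
  let ?m = "\<lambda>v. mean T (\<lambda>n. F n v) + inner (mean T h) v"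
  have "eventually (\<lambda>v. norm v powr (- \<alpha>) * ?m v \<le> - (K + \<bar>B\<bar>) / real T) at_infinity"
    using limit by (auto simp: filterlim_at_bot)
  then obtain M where M:
    "\<And>v. M \<le> norm v \<Longrightarrow> norm v powr (- \<alpha>) * ?m v \<le> - (K + \<bar>B\<bar>) / real T"
    by (auto simp: eventually_at_infinity)
  have "potential T F h u \<le> B"
    if u: "fdiff_norm T u \<le> a" and big: "max M (max 1 R) \<le> norm (u 0)" for u
  proof -
    let ?P = "norm (u 0) powr \<alpha>"
    have P: "1 \<le> ?P" using big \<open>\<alpha> \<ge> 0\<close> by (simp add: ge_one_powr_ge_zero)
    have "real T * ?m (u 0) = ?P * (real T * (norm (u 0) powr (- \<alpha>) * ?m (u 0)))"
      using big by (simp add: powr_minus) (auto simp: field_simps)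
    also have "\<dots> \<le> ?P * (real T * (- (K + \<bar>B\<bar>) / real T))"
      using big by (intro mult_left_mono M) auto
    also have "\<dots> = - (K + \<bar>B\<bar>) * ?P" using \<open>T \<ge> 1\<close> by simp
    finally have "real T * ?m (u 0) \<le> - (K + \<bar>B\<bar>) * ?P" .
    moreover have "potential T F h u \<le> real T * ?m (u 0) + K * ?P"
      unfolding K_def
    proof (rule potential_le_mean[OF assms(1-3) deriv growth])
      fix n assume n: "n \<in> {1..T}"
      then have "norm (u n - u 0) \<le> real n * a"
        using norm_diff_le_of_fdiff_norm[OF u, of n] by simp
      also have "\<dots> \<le> R" using n \<open>a \<ge> 0\<close> by (simp add: R_def mult_right_mono)
      finally show "norm (u n - u 0) \<le> R" .
    qed (use big in auto)
    ultimately have "potential T F h u \<le> - \<bar>B\<bar> * ?P" by (simp add: algebra_simps)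
    also have "\<dots> \<le> - \<bar>B\<bar>" using mult_left_mono[OF P, of "\<bar>B\<bar>"] by simp
    finally show ?thesis by simp
  qed
  then show ?thesis by blast
qed

text \<open>
  On a suitable compact set the energy is continuous plus lower semicontinuous. Outside it the energy
  is nonnegative: either some difference is too long and the energy is infinite, or \<open>norm (u 0)\<close> is
  large and coercivity applies. The zero function has energy 0.
\<close>

lemma Energy_attains_min:
  fixes F :: "nat \<Rightarrow> 'a::euclidean_space \<Rightarrow> real"
  assumes "a \<ge> 0"
    and \<Phi>: "continuous_on (cball 0 a) \<Phi>" "\<Phi> 0 = 0"
    and F: "\<And>n. n \<in> {1..T} \<Longrightarrow> continuous_on UNIV (F n)" "\<And>n. n \<in> {1..T} \<Longrightarrow> F n 0 = 0"
    and j: "lsc_fun j" "\<And>z. 0 \<le> j z" "j (0, 0) = 0"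
    and coercive: "\<And>B. \<exists>M. \<forall>u. fdiff_norm T u \<le> a \<and> M \<le> norm (u 0) \<longrightarrow> potential T F h u \<le> B"
  shows "\<exists>u\<in>dom_PsiJ T a j. \<forall>v. Energy T a \<Phi> j F h u \<le> Energy T a \<Phi> j F h v"
proof -
  let ?E = "Energy T a \<Phi> j F h"
  have jm: "j z \<noteq> -\<infinity>" for z using j(2)[of z] by auto
  obtain x where "x \<in> cball 0 a" and x: "\<And>y. y \<in> cball 0 a \<Longrightarrow> \<Phi> x \<le> \<Phi> y"
    using continuous_attains_inf[OF compact_cball _ \<Phi>(1)] \<open>a \<ge> 0\<close> by auto
  \<comment> \<open>This bound on the potential makes the energy nonnegative, as \<open>\<Phi> x\<close> is the minimum of \<open>\<Phi>\<close>.\<close>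
  obtain M0 where M0: "\<And>u. fdiff_norm T u \<le> a \<Longrightarrow> M0 \<le> norm (u 0) \<Longrightarrow>
      potential T F h u \<le> (real T + 1) * \<Phi> x"
    using coercive by blast
  define M where "M = max 0 M0"
  define K where "K = {u \<in> X_space T. fdiff_norm T u \<le> a \<and> norm (u 0 :: 'a) \<le> M}"
  \<comment> \<open>The zero element of \<open>X_space T\<close>, which is undefined beyond \<open>T + 1\<close>.\<close>
  define z where "z = restrict (\<lambda>_. 0 :: 'a) {0..T + 1}"
  have z_in: "z \<in> K"
    using \<open>a \<ge> 0\<close> by (auto simp: K_def z_def X_space_def fdiff_norm_le_iff fdiff_def M_def)
  have E_z: "?E z = 0"
  proof -
    have "?E (\<lambda>_. 0) = 0"
      using \<open>a \<ge> 0\<close> \<Phi>(2) F(2) j(3)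
      by (subst Energy_inside) (auto simp: fdiff_norm_le_iff fdiff_def potential_def)
    then show ?thesis by (simp only: z_def Energy_restrict)
  qed
  have coord: "continuous_on K (\<lambda>u. u i)" for i
    by (rule continuous_on_subset[OF continuous_on_product_coordinates]) simp
  let ?S = "\<lambda>u. (\<Sum>k\<le>T. \<Phi> (fdiff u k)) - potential T F h u"
  have S_cont: "continuous_on K ?S"
    unfolding potential_def
  proof (intro continuous_intros continuous_on_compose2[OF \<Phi>(1)] continuous_on_compose2[OF F(1)])
    fix k assume "k \<in> {..T}"
    then show "(\<lambda>u. fdiff u k) ` K \<subseteq> cball 0 a"
      by (auto simp: K_def fdiff_norm_le_iff)
  qed (auto simp: fdiff_def intro!: continuous_intros coord)
  have "\<exists>u\<in>K. \<forall>v\<in>K. ereal (?S u) + j (u 0, u (T + 1)) \<le> ereal (?S v) + j (v 0, v (T + 1))"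
  proof (rule compact_lsc_attains_min)
    show "compact K" unfolding K_def by (rule compact_bounded_differences) fact
    show "K \<noteq> {}" using z_in by auto
    fix u c assume u: "u \<in> K" "c < ereal (?S u) + j (u 0, u (T + 1))"
    show "\<exists>U. open U \<and> u \<in> U \<and> (\<forall>v\<in>U \<inter> K. c < ereal (?S v) + j (v 0, v (T + 1)))"
    proof (rule lsc_add_continuous[OF S_cont, where g = "\<lambda>v. j (v 0, v (T + 1))"])
      fix r
      have "continuous_on UNIV (\<lambda>v :: nat \<Rightarrow> 'a. (v 0, v (T + 1)))"
        by (intro continuous_intros continuous_on_product_coordinates)
      from open_vimage[OF lsc_fun_open_superlevel[OF j(1), of r] this]
      show "open {v. r < j (v 0, v (T + 1))}" by (simp add: vimage_def)
    qed (use u jm in auto)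
  qed
  then obtain u where u: "u \<in> K"
    and min: "\<And>v. v \<in> K \<Longrightarrow> ereal (?S u) + j (u 0, u (T + 1)) \<le> ereal (?S v) + j (v 0, v (T + 1))"
    by blast
  have minK: "?E u \<le> ?E v" if "v \<in> K" for v
    using min[OF that] u that by (auto simp: Energy_inside K_def)
  then have neg: "?E u \<le> 0" using z_in E_z by fastforce
  have minX: "?E u \<le> ?E v" if v: "v \<in> X_space T" for v
  proof (cases "v \<in> K")
    case False
    show ?thesis
    proof (cases "fdiff_norm T v \<le> a")
      case True
      then have "M0 \<le> norm (v 0)" using False v by (auto simp: K_def M_def)
      then have "potential T F h v \<le> (real T + 1) * \<Phi> x" by (rule M0[OF True])
      also have "\<dots> = (\<Sum>k\<le>T. \<Phi> x)" by simp
      also have "\<dots> \<le> (\<Sum>k\<le>T. \<Phi> (fdiff v k))"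
        using True by (intro sum_mono x) (simp add: fdiff_norm_le_iff)
      finally have "0 \<le> ereal (?S v)" by simp
      then have "0 \<le> ?E v" using j(2) by (simp add: Energy_inside[OF True])
      then show ?thesis using neg by (rule order_trans[rotated])
    qed (simp add: Energy_outside jm)
  qed (rule minK)
  have "?E u \<le> ?E v" for v
    using minX[of "restrict v {0..T + 1}"] by (simp only: Energy_restrict) (simp add: X_space_def)
  moreover have "u \<in> dom_PsiJ T a j"
  proof -
    have "fdiff_norm T u \<le> a" "u \<in> X_space T" using u by (auto simp: K_def)
    moreover have "j (u 0, u (T + 1)) \<noteq> \<infinity>"
      using neg by (auto simp: Energy_inside[OF \<open>fdiff_norm T u \<le> a\<close>])
    ultimately show ?thesis by (simp add: dom_PsiJ_def eff_dom_def less_top[symmetric])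
  qed
  ultimately show ?thesis by blast
qed

section \<open>First variation of the energy at a minimizer\<close>

lemma potential_along_line:
  assumes "\<And>n. n \<in> {1..T} \<Longrightarrow> GDERIV (F n) (u n) :> g n"
  shows "((\<lambda>t. potential T F h (\<lambda>n. u n + t *\<^sub>R w n)) has_real_derivative
    (\<Sum>n=1..T. inner (g n + h n) (w n))) (at 0)"
proof -
  have "((\<lambda>t. inner (h n) (u n + t *\<^sub>R w n)) has_real_derivative inner (h n) (w n)) (at 0)" for n
    by (auto intro!: derivative_eq_intros simp: inner_add_right)
  then show ?thesis
    unfolding potential_def inner_add_left
    by (intro DERIV_sum DERIV_add GDERIV_along_line[where f = "F _"] assms) auto
qed

text \<open>
  Minimality along the segment from \<open>u\<close> to \<open>u + w\<close>, with the boundary term replaced by its chord.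
\<close>

lemma minimizer_increment:
  assumes conv: "convex_fun j" and min: "\<And>v. Energy T a \<Phi> j F h u \<le> Energy T a \<Phi> j F h v"
    and j: "j (u 0, u (T + 1)) = ereal p" "j (u 0 + w 0, u (T + 1) + w (T + 1)) = ereal q"
    and inside: "\<And>k. k \<le> T \<Longrightarrow> norm (fdiff u k) \<le> a"
      "\<And>k. k \<le> T \<Longrightarrow> norm (fdiff u k + t *\<^sub>R fdiff w k) \<le> a"
    and t: "0 \<le> t" "t \<le> 1"
  shows "(\<Sum>k\<le>T. \<Phi> (fdiff u k)) - potential T F h u
    \<le> (\<Sum>k\<le>T. \<Phi> (fdiff u k + t *\<^sub>R fdiff w k)) - potential T F h (\<lambda>n. u n + t *\<^sub>R w n)
      + t * (q - p)"
proof -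
  define v where "v = (\<lambda>n. u n + t *\<^sub>R w n)"
  have dv: "fdiff v k = fdiff u k + t *\<^sub>R fdiff w k" for k
    by (simp add: v_def fdiff_def algebra_simps)
  have "(v 0, v (T + 1))
      = (1 - t) *\<^sub>R (u 0, u (T + 1)) + t *\<^sub>R (u 0 + w 0, u (T + 1) + w (T + 1))"
    by (simp add: v_def algebra_simps)
  then have "j (v 0, v (T + 1)) \<le> ereal ((1 - t) * p + t * q)"
    using conv t j unfolding convex_fun_def by (metis plus_ereal.simps(1) times_ereal.simps(1))
  then have "ereal ((\<Sum>k\<le>T. \<Phi> (fdiff v k)) - potential T F h v) + j (v 0, v (T + 1))
      \<le> ereal ((\<Sum>k\<le>T. \<Phi> (fdiff v k)) - potential T F h v) + ereal ((1 - t) * p + t * q)"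
    by (rule add_left_mono)
  moreover have "Energy T a \<Phi> j F h v
      = ereal ((\<Sum>k\<le>T. \<Phi> (fdiff v k)) - potential T F h v) + j (v 0, v (T + 1))"
    using inside(2) by (intro Energy_inside) (simp add: fdiff_norm_le_iff dv)
  ultimately have "Energy T a \<Phi> j F h u
      \<le> ereal ((\<Sum>k\<le>T. \<Phi> (fdiff v k)) - potential T F h v) + ereal ((1 - t) * p + t * q)"
    using min[of v] by simp
  moreover have "Energy T a \<Phi> j F h u
      = ereal ((\<Sum>k\<le>T. \<Phi> (fdiff u k)) - potential T F h u) + ereal p"
    using inside(1) j(1) by (subst Energy_inside) (auto simp: fdiff_norm_le_iff)
  ultimately show ?thesis by (simp add: dv v_def[symmetric] algebra_simps)
qed

section \<open>Minimizers stay away from the constraint\<close>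

text \<open>
  Moving from a point of the sphere towards the centre, \<open>\<Phi>\<close> drops faster than any linear
  function, because the gradient \<open>\<phi>\<close> blows up at the sphere.
\<close>

lemma convex_steep_at_sphere:
  fixes \<Phi> :: "'a::euclidean_space \<Rightarrow> real"
  assumes "a > 0" and hom: "homeomorphism (ball 0 a) UNIV \<phi> \<psi>"
    and deriv: "\<And>y. y \<in> ball 0 a \<Longrightarrow> GDERIV \<Phi> y :> \<phi> y"
    and conv: "convex_on (cball 0 a) \<Phi>" and cont: "continuous_on (cball 0 a) \<Phi>"
    and x: "norm x = a"
  shows "eventually (\<lambda>t. \<Phi> ((1 - t) *\<^sub>R x) + t * B \<le> \<Phi> x) (at_right 0)"
proof -
  have "bounded (\<Phi> ` cball 0 a)"
    by (intro compact_imp_bounded compact_continuous_image cont compact_cball)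
  then obtain Q where Q: "\<And>y. y \<in> cball 0 a \<Longrightarrow> \<bar>\<Phi> y\<bar> \<le> Q"
    unfolding bounded_iff by force
  have "0 \<le> Q" using Q[of 0] \<open>a > 0\<close> by simp
  obtain \<rho> where \<rho>: "\<rho> < a"
    "\<And>y. y \<in> ball 0 a \<Longrightarrow> \<rho> < norm y \<Longrightarrow> (\<bar>B\<bar> + 2 * Q) / (a / 2) < norm (\<phi> y)"
    using homeomorphism_ball_UNIV_blowup[OF hom] by blast
  show ?thesis
  proof (rule eventually_at_rightI)
    show "0 < min 1 ((a - \<rho>) / a)" using \<rho>(1) \<open>a > 0\<close> by simp
    fix t assume "t \<in> {0<..<min 1 ((a - \<rho>) / a)}"
    then have t: "0 < t" "t < 1" "t * a < a - \<rho>" using \<open>a > 0\<close> by (auto simp: field_simps)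
    define y where "y = (1 - t) *\<^sub>R x"
    define p where "p = \<phi> y"
    have ny: "norm y = (1 - t) * a" using t x by (simp add: y_def)
    moreover have "0 < t * a" using t \<open>a > 0\<close> by simp
    ultimately have "norm y < a" "\<rho> < norm y" using t by (auto simp: algebra_simps)
    then have y: "y \<in> ball 0 a" and big: "(\<bar>B\<bar> + 2 * Q) / (a / 2) < norm p"
      using \<rho>(2)[of y] by (auto simp: p_def)
    have "0 \<le> (\<bar>B\<bar> + 2 * Q) / (a / 2)" using \<open>0 \<le> Q\<close> \<open>a > 0\<close> by simp
    then have np: "0 < norm p" using big by linarith
    have D: "GDERIV \<Phi> y :> p" unfolding p_def by (rule deriv[OF y])
    \<comment> \<open>Testing the tangent plane at \<open>y\<close> with a point in direction \<open>p\<close> shows that \<open>inner p y\<close> grows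
        like \<open>norm p\<close>.\<close>
    define z where "z = (a / 2 / norm p) *\<^sub>R p"
    have z: "z \<in> cball 0 a" using np \<open>a > 0\<close> by (simp add: z_def)
    have "\<Phi> y + inner p (z - y) \<le> \<Phi> z"
      using y z by (intro convex_on_above_tangent_plane[OF conv _ _ D]) auto
    moreover have "inner p z = (a / 2) * norm p"
      using np by (simp add: z_def dot_square_norm power2_eq_square)
    moreover have "\<bar>B\<bar> + 2 * Q \<le> (a / 2) * norm p"
      using big \<open>a > 0\<close> by (simp add: field_simps)
    moreover have "\<bar>\<Phi> y\<bar> \<le> Q" "\<bar>\<Phi> z\<bar> \<le> Q" using Q y z by auto
    ultimately have "\<bar>B\<bar> \<le> inner p y" by (simp add: inner_diff_right)
    then have *: "\<bar>B\<bar> \<le> (1 - t) * inner p x" by (simp add: y_def)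
    then have "0 \<le> (1 - t) * inner p x" by linarith
    then have "0 \<le> inner p x" using t by (simp add: zero_le_mult_iff)
    then have "(1 - t) * inner p x \<le> inner p x" using t by (intro mult_left_le_one_le) auto
    then have "t * B \<le> t * inner p x" using * t by (intro mult_left_mono) auto
    moreover have "\<Phi> y + inner p (x - y) \<le> \<Phi> x"
      using y x by (intro convex_on_above_tangent_plane[OF conv _ _ D]) auto
    moreover have "x - y = t *\<^sub>R x" by (simp add: y_def algebra_simps)
    ultimately show "\<Phi> ((1 - t) *\<^sub>R x) + t * B \<le> \<Phi> x" by (simp add: y_def[symmetric])
  qed
qed

text \<open>
  The competitor is \<open>(1 - t) *\<^sub>R u\<close>. All terms of the energy increase by at most \<open>O(t)\<close>, whereas a
  difference of length exactly \<open>a\<close> makes its term decrease by more than any multiple of \<open>t\<close>.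
\<close>

lemma minimizer_strictly_inside:
  fixes \<Phi> :: "'a::euclidean_space \<Rightarrow> real"
  assumes "a > 0" and hom: "homeomorphism (ball 0 a) UNIV \<phi> \<psi>"
    and \<Phi>: "\<And>y. y \<in> ball 0 a \<Longrightarrow> GDERIV \<Phi> y :> \<phi> y"
      "convex_on (cball 0 a) \<Phi>" "continuous_on (cball 0 a) \<Phi>" "\<Phi> 0 = 0"
    and F: "\<And>n z. n \<in> {1..T} \<Longrightarrow> GDERIV (F n) z :> g n z"
    and j: "convex_fun j" "j (0, 0) = 0" "j (u 0, u (T + 1)) = ereal p"
    and inside: "fdiff_norm T u \<le> a"
    and min: "\<And>v. Energy T a \<Phi> j F h u \<le> Energy T a \<Phi> j F h v"
  shows "fdiff_norm T u < a"
proof (rule ccontr)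
  assume "\<not> fdiff_norm T u < a"
  then obtain m where m: "m \<le> T" "norm (fdiff u m) = a"
    using inside by (force simp: fdiff_norm_less_iff fdiff_norm_le_iff)
  have du: "norm (fdiff u k) \<le> a" if "k \<le> T" for k
    using inside that by (simp add: fdiff_norm_le_iff)
  let ?w = "\<lambda>n. - u n"
  let ?pot = "\<lambda>t. potential T F h (\<lambda>n. u n + t *\<^sub>R ?w n)"
  define D where "D = (\<Sum>n=1..T. inner (g n (u n) + h n) (?w n))"
  define S where "S = (\<Sum>k\<in>{..T} - {m}. \<Phi> (fdiff u k))"
  \<comment> \<open>The rate of decrease that contradicts the first-order condition.\<close>
  define B where "B = 1 - D - S - p"
  have "((\<lambda>t. - ?pot t) has_real_derivative - D) (at 0)"
    unfolding D_def by (intro DERIV_minus potential_along_line F)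
  moreover have "eventually (\<lambda>t. \<Phi> ((1 - t) *\<^sub>R fdiff u m) + t * B \<le> \<Phi> (fdiff u m)) (at_right 0)"
    by (rule convex_steep_at_sphere[OF \<open>a > 0\<close> hom \<Phi>(1-3) m(2)])
  then have "eventually (\<lambda>t. - ?pot 0 \<le> - ?pot t + t * (- S - B - p)) (at_right 0)"
    using eventually_at_right_real[OF zero_less_one]
  proof eventually_elim
    case (elim t)
    then have t: "0 < t" "t < 1" by auto
    have scale: "fdiff u k + t *\<^sub>R fdiff ?w k = (1 - t) *\<^sub>R fdiff u k" for k
      by (simp add: fdiff_def algebra_simps)
    have norm: "norm ((1 - t) *\<^sub>R fdiff u k) \<le> a" if "k \<le> T" for k
      using mult_mono[of "1 - t" 1 "norm (fdiff u k)" a] du[OF that] t \<open>a > 0\<close> by simp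
    have "\<Phi> ((1 - t) *\<^sub>R fdiff u k) \<le> (1 - t) * \<Phi> (fdiff u k)" if "k \<le> T" for k
      using convex_onD[OF \<Phi>(2), of t "fdiff u k" 0] du[OF that] t \<open>a > 0\<close> \<Phi>(4) by simp
    then have "(\<Sum>k\<in>{..T} - {m}. \<Phi> ((1 - t) *\<^sub>R fdiff u k)) \<le> (1 - t) * S"
      unfolding S_def sum_distrib_left by (intro sum_mono) simp
    then have "(\<Sum>k\<le>T. \<Phi> ((1 - t) *\<^sub>R fdiff u k))
        \<le> \<Phi> (fdiff u m) - t * B + (1 - t) * S"
      using elim m(1) by (simp add: sum.remove[of "{..T}" m])
    moreover have "(\<Sum>k\<le>T. \<Phi> (fdiff u k)) = \<Phi> (fdiff u m) + S"
      using m(1) by (simp add: S_def sum.remove[of "{..T}" m])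
    moreover have "(\<Sum>k\<le>T. \<Phi> (fdiff u k)) - potential T F h u
        \<le> (\<Sum>k\<le>T. \<Phi> (fdiff u k + t *\<^sub>R fdiff ?w k)) - ?pot t + t * (0 - p)"
    proof (rule minimizer_increment[OF j(1) min j(3)])
      show "j (u 0 + ?w 0, u (T + 1) + ?w (T + 1)) = ereal 0" using j(2) by (simp add: zero_ereal_def)
    qed (use du norm scale t in auto)
    ultimately show ?case by (simp add: scale algebra_simps)
  qed
  ultimately have "0 \<le> - D + (- S - B - p)" by (rule right_derivative_ge)
  then show False by (simp add: B_def)
qed

section \<open>The variational inequality and its consequences\<close>

lemma minimizer_variational_inequality:
  fixes \<Phi> :: "'a::euclidean_space \<Rightarrow> real"
  assumes inside: "fdiff_norm T u < a"
    and \<Phi>: "\<And>y. y \<in> ball 0 a \<Longrightarrow> GDERIV \<Phi> y :> \<phi> y"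
    and F: "\<And>n z. n \<in> {1..T} \<Longrightarrow> GDERIV (F n) z :> g n z"
    and j: "convex_fun j" "j (u 0, u (T + 1)) = ereal p"
      "j (u 0 + w 0, u (T + 1) + w (T + 1)) = ereal q"
    and min: "\<And>v. Energy T a \<Phi> j F h u \<le> Energy T a \<Phi> j F h v"
  shows "0 \<le> (\<Sum>k\<le>T. inner (\<phi> (fdiff u k)) (fdiff w k))
    - (\<Sum>n=1..T. inner (g n (u n) + h n) (w n)) + (q - p)"
proof -
  let ?G = "\<lambda>t. (\<Sum>k\<le>T. \<Phi> (fdiff u k + t *\<^sub>R fdiff w k))
    - potential T F h (\<lambda>n. u n + t *\<^sub>R w n)"
  have du: "norm (fdiff u k) < a" if "k \<le> T" for k
    using inside that by (simp add: fdiff_norm_less_iff)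
  have "(?G has_real_derivative (\<Sum>k\<le>T. inner (\<phi> (fdiff u k)) (fdiff w k))
    - (\<Sum>n=1..T. inner (g n (u n) + h n) (w n))) (at 0)"
    using du by (intro DERIV_diff DERIV_sum potential_along_line F GDERIV_along_line \<Phi>) auto
  moreover have "eventually (\<lambda>t. ?G 0 \<le> ?G t + t * (q - p)) (at_right 0)"
  proof -
    have "eventually (\<lambda>t. norm (fdiff u k + t *\<^sub>R fdiff w k) < a) (at_right 0)" if "k \<le> T" for k
    proof (rule order_tendstoD(2))
      show "((\<lambda>t. norm (fdiff u k + t *\<^sub>R fdiff w k))
          \<longlongrightarrow> norm (fdiff u k + 0 *\<^sub>R fdiff w k)) (at_right 0)"
        by (intro tendsto_intros)
    qed (use du that in simp)
    then have "eventually (\<lambda>t. \<forall>k\<in>{..T}. norm (fdiff u k + t *\<^sub>R fdiff w k) < a) (at_right 0)"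
      by (intro eventually_ball_finite) auto
    then show ?thesis
      using eventually_at_right_real[OF zero_less_one]
    proof eventually_elim
      case (elim t)
      then show ?case
        using minimizer_increment[OF j(1) min j(2,3), of t] du by (auto intro: less_imp_le)
    qed
  qed
  ultimately show ?thesis by (rule right_derivative_ge)
qed

text \<open>
  Test with a perturbation at the single interior node \<open>n\<close>; its value is minus the residual of
  the equation, so the variational inequality forces the residual to vanish.
\<close>

lemma minimizer_difference_equation:
  fixes \<Phi> :: "'a::euclidean_space \<Rightarrow> real"
  assumes inside: "fdiff_norm T u < a"
    and \<Phi>: "\<And>y. y \<in> ball 0 a \<Longrightarrow> GDERIV \<Phi> y :> \<phi> y"
    and F: "\<And>n z. n \<in> {1..T} \<Longrightarrow> GDERIV (F n) z :> g n z"
    and j: "convex_fun j" "j (u 0, u (T + 1)) = ereal p"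
    and min: "\<And>v. Energy T a \<Phi> j F h u \<le> Energy T a \<Phi> j F h v"
    and n: "n \<in> {1..T}"
  shows "- fdiff (\<lambda>k. \<phi> (fdiff u k)) (n - 1) = g n (u n) + h n"
proof -
  define r where "r = \<phi> (fdiff u (n - 1)) - \<phi> (fdiff u n) - (g n (u n) + h n)"
  define w where "w = (\<lambda>m. if m = n then - r else 0)"
  have dw: "fdiff w k = (if k = n - 1 then - r else 0) - (if k = n then - r else 0)" for k
    using n by (auto simp: w_def fdiff_def)
  have "(\<Sum>k\<le>T. inner (\<phi> (fdiff u k)) (fdiff w k))
      = (\<Sum>k\<le>T. if k = n - 1 then inner (\<phi> (fdiff u k)) (- r) else 0)
        - (\<Sum>k\<le>T. if k = n then inner (\<phi> (fdiff u k)) (- r) else 0)"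
    unfolding sum_subtractf[symmetric] by (rule sum.cong) (auto simp: dw inner_diff_right)
  also have "\<dots> = - inner (\<phi> (fdiff u (n - 1)) - \<phi> (fdiff u n)) r"
    using n by (auto simp: inner_diff_left)
  finally have 1: "(\<Sum>k\<le>T. inner (\<phi> (fdiff u k)) (fdiff w k))
      = - inner (\<phi> (fdiff u (n - 1)) - \<phi> (fdiff u n)) r" .
  have "(\<Sum>m=1..T. inner (g m (u m) + h m) (w m))
      = (\<Sum>m=1..T. if m = n then inner (g m (u m) + h m) (- r) else 0)"
    by (rule sum.cong) (auto simp: w_def)
  also have "\<dots> = - inner (g n (u n) + h n) r"
    using n by simp
  finally have 2: "(\<Sum>m=1..T. inner (g m (u m) + h m) (w m)) = - inner (g n (u n) + h n) r" .
  have "w 0 = 0" "w (T + 1) = 0" using n by (auto simp: w_def)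
  then have "0 \<le> (\<Sum>k\<le>T. inner (\<phi> (fdiff u k)) (fdiff w k))
      - (\<Sum>m=1..T. inner (g m (u m) + h m) (w m)) + (p - p)"
    using j(2) by (intro minimizer_variational_inequality[OF inside \<Phi> F j _ min]) auto
  then have "inner r r \<le> 0" unfolding 1 2 by (simp add: r_def inner_diff_left)
  then have "r = 0" by (metis inner_ge_zero inner_eq_zero_iff order_antisym)
  then show ?thesis using n by (simp add: r_def fdiff_def algebra_simps)
qed

text \<open>
  Test with perturbations at the two end nodes only. These are distinct from the interior nodes and
  not adjacent to each other, since \<open>T \<ge> 1\<close>.
\<close>

lemma minimizer_boundary_condition:
  fixes \<Phi> :: "'a::euclidean_space \<Rightarrow> real"
  assumes inside: "fdiff_norm T u < a" and "T \<ge> 1"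
    and \<Phi>: "\<And>y. y \<in> ball 0 a \<Longrightarrow> GDERIV \<Phi> y :> \<phi> y"
    and F: "\<And>n z. n \<in> {1..T} \<Longrightarrow> GDERIV (F n) z :> g n z"
    and j: "convex_fun j" "\<And>z. j z \<noteq> -\<infinity>" "j (u 0, u (T + 1)) = ereal p"
    and min: "\<And>v. Energy T a \<Phi> j F h u \<le> Energy T a \<Phi> j F h v"
  shows "(\<phi> (fdiff u 0), - \<phi> (fdiff u T)) \<in> subdiff j (u 0, u (T + 1))"
  unfolding subdiff_def mem_Collect_eq
proof
  fix y
  let ?\<zeta> = "(\<phi> (fdiff u 0), - \<phi> (fdiff u T))"
  show "j (u 0, u (T + 1)) + ereal (inner ?\<zeta> (y - (u 0, u (T + 1)))) \<le> j y"
  proof (cases "j y")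
    case (real q)
    define b where "b = fst y - u 0"
    define e where "e = snd y - u (T + 1)"
    define w where "w = (\<lambda>m. if m = 0 then b else if m = T + 1 then e else 0)"
    have dw: "fdiff w k = (if k = T then e else 0) - (if k = 0 then b else 0)" if "k \<le> T" for k
      using that \<open>T \<ge> 1\<close> by (auto simp: w_def fdiff_def)
    have "(\<Sum>k\<le>T. inner (\<phi> (fdiff u k)) (fdiff w k))
        = (\<Sum>k\<le>T. if k = T then inner (\<phi> (fdiff u k)) e else 0)
          - (\<Sum>k\<le>T. if k = 0 then inner (\<phi> (fdiff u k)) b else 0)"
      unfolding sum_subtractf[symmetric] by (rule sum.cong) (auto simp: dw inner_diff_right)
    also have "\<dots> = inner (\<phi> (fdiff u T)) e - inner (\<phi> (fdiff u 0)) b"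
      by simp
    finally have 1: "(\<Sum>k\<le>T. inner (\<phi> (fdiff u k)) (fdiff w k))
        = inner (\<phi> (fdiff u T)) e - inner (\<phi> (fdiff u 0)) b" .
    have 2: "(\<Sum>m=1..T. inner (g m (u m) + h m) (w m)) = 0"
      by (rule sum.neutral) (auto simp: w_def)
    have "j (u 0 + w 0, u (T + 1) + w (T + 1)) = ereal q"
      using real by (simp add: w_def b_def e_def)
    from minimizer_variational_inequality[OF inside \<Phi> F j(1,3) this min]
    have "0 \<le> (\<Sum>k\<le>T. inner (\<phi> (fdiff u k)) (fdiff w k))
        - (\<Sum>m=1..T. inner (g m (u m) + h m) (w m)) + (q - p)" by simp
    then have "p + (inner (\<phi> (fdiff u 0)) b - inner (\<phi> (fdiff u T)) e) \<le> q"
      unfolding 1 2 by simp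
    moreover have "inner ?\<zeta> (y - (u 0, u (T + 1)))
        = inner (\<phi> (fdiff u 0)) b - inner (\<phi> (fdiff u T)) e"
      by (cases y) (simp add: b_def e_def)
    ultimately show ?thesis using real j(3) by simp
  qed (use j(2) in auto)
qed

section \<open>Existence of a solution\<close>

theorem theorem5p4:
  fixes T :: nat and a :: real
    and \<phi> :: "real ^ 'n \<Rightarrow> real ^ 'n" and \<Phi> :: "real ^ 'n \<Rightarrow> real"
    and F :: "nat \<Rightarrow> real ^ 'n \<Rightarrow> real"
    and j :: "(real ^ 'n) \<times> (real ^ 'n) \<Rightarrow> ereal"
    and h :: "nat \<Rightarrow> real ^ 'n"
    and \<alpha> c :: real
  assumes "T \<ge> 2" and "a > 0"
    and phi_homeo: "\<exists>\<psi>. homeomorphism (ball 0 a) UNIV \<phi> \<psi>"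
    and phi_0: "\<phi> 0 = 0"
    and phi_grad: "\<forall>x\<in>ball 0 a. \<phi> x = grad \<Phi> x"
    and Phi_C1: "C1_on (ball 0 a) \<Phi>"
    and Phi_cont: "continuous_on (cball 0 a) \<Phi>"
    and Phi_convex: "strictly_convex_on (cball 0 a) \<Phi>"
    and Phi_0: "\<Phi> 0 = 0"
    and F_cont: "continuous_on ({1..T} \<times> UNIV) (\<lambda>(n, v). F n v)"
    and F_diff: "\<forall>n\<in>{1..T}. \<forall>v. F n differentiable (at v)"
    and F_grad_cont: "continuous_on ({1..T} \<times> UNIV) (\<lambda>(n, v). grad (F n) v)"
    and F_0: "\<forall>n\<in>{1..T}. F n 0 = 0"
    and j_proper: "proper_fun j"
    and j_convex: "convex_fun j"
    and j_lsc: "lsc_fun j"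
    and j_0: "j (0, 0) = 0"
    and j_subdiff_0: "(0, 0) \<in> subdiff j (0, 0)"
    and "\<alpha> \<ge> 0" and "c \<ge> 0"
    and growth: "\<forall>n\<in>{1..T}. \<forall>v. norm (grad (F n) v) \<le> c * (norm v powr \<alpha> + 1)"
    and limit: "filterlim
      (\<lambda>v. norm v powr (- \<alpha>) * (mean T (\<lambda>n. F n v) + inner (mean T h) v)) at_bot at_infinity"
  shows "(\<exists>m::real. \<forall>u\<in>X_space T. ereal m \<le> Energy T a \<Phi> j F h u) \<and>
    (\<exists>u\<in>dom_PsiJ T a j.
       Energy T a \<Phi> j F h u = (INF w\<in>X_space T. Energy T a \<Phi> j F h w) \<and>
       is_solution T a \<phi> j F h u)"
proof -
  let ?E = "Energy T a \<Phi> j F h"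
  obtain \<psi> where hom: "homeomorphism (ball 0 a) UNIV \<phi> \<psi>" using phi_homeo by blast
  have \<Phi>_deriv: "GDERIV \<Phi> y :> \<phi> y" if "y \<in> ball 0 a" for y
    using Phi_C1 phi_grad that GDERIV_grad[of \<Phi> y] by (simp add: C1_on_def)
  have F_deriv: "GDERIV (F n) z :> grad (F n) z" if "n \<in> {1..T}" for n z
    using F_diff that by (intro GDERIV_grad) blast
  have F_cont': "continuous_on UNIV (F n)" if "n \<in> {1..T}" for n
    using F_diff that
    by (intro differentiable_imp_continuous_on) (auto simp: differentiable_on_def)
  have j_nonneg: "0 \<le> j z" for z
    using j_subdiff_0 j_0 by (cases z) (simp add: subdiff_def flip: zero_ereal_def)
  have j_neq: "j z \<noteq> -\<infinity>" for z using j_nonneg[of z] by auto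
  have conv: "convex_on (cball 0 a) \<Phi>"
    by (rule strictly_convex_on_imp_convex_on) fact
  have coercive: "\<exists>M. \<forall>u. fdiff_norm T u \<le> a \<and> M \<le> norm (u 0) \<longrightarrow> potential T F h u \<le> B"
    for B
    using assms(1,2) growth
    by (intro potential_coercive[OF _ \<open>\<alpha> \<ge> 0\<close> \<open>c \<ge> 0\<close> _ F_deriv _ limit]) auto
  have "\<exists>u\<in>dom_PsiJ T a j. \<forall>v. ?E u \<le> ?E v"
    using F_0 \<open>a > 0\<close>
    by (intro Energy_attains_min[OF _ Phi_cont Phi_0 F_cont' _ j_lsc j_nonneg j_0 coercive]) auto
  then obtain u where u: "u \<in> dom_PsiJ T a j" and min: "\<And>v. ?E u \<le> ?E v"
    by blast
  have uX: "u \<in> X_space T" and le: "fdiff_norm T u \<le> a" and "j (u 0, u (T + 1)) < \<infinity>"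
    using u by (auto simp: dom_PsiJ_def eff_dom_def)
  then obtain p where p: "j (u 0, u (T + 1)) = ereal p"
    using j_neq by (cases "j (u 0, u (T + 1))") auto
  have less: "fdiff_norm T u < a"
    by (rule minimizer_strictly_inside[OF \<open>a > 0\<close> hom \<Phi>_deriv conv Phi_cont Phi_0 F_deriv
          j_convex j_0 p le min])
  have bc: "(\<phi> (fdiff u 0), - \<phi> (fdiff u T)) \<in> subdiff j (u 0, u (T + 1))"
    using minimizer_boundary_condition[OF less _ \<Phi>_deriv F_deriv j_convex j_neq p min] \<open>T \<ge> 2\<close>
    by simp
  have "is_solution T a \<phi> j F h u"
    unfolding is_solution_def
  proof (intro conjI ballI)
    fix n assume "n \<in> {1..T}"
    from minimizer_difference_equation[OF less \<Phi>_deriv F_deriv j_convex p min this]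
    show "- fdiff (\<lambda>k. \<phi> (fdiff u k)) (n - 1) = grad (F n) (u n) + h n"
      by simp
  qed (use uX less bc in auto)
  moreover have "?E u = (INF w\<in>X_space T. ?E w)"
    by (intro antisym INF_greatest min INF_lower uX)
  moreover have "?E u = ereal ((\<Sum>k\<le>T. \<Phi> (fdiff u k)) - potential T F h u + p)"
    using Energy_inside[OF le] p by simp
  then have "\<exists>m::real. \<forall>v\<in>X_space T. ereal m \<le> ?E v"
    using min by (metis (no_types))
  ultimately show ?thesis using u by blast
qed

end
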